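(* For every $f\ge0$, $$\begin{aligned}F_{2,f}(t)={}&(6f+3)\,t(1+t)^{f+2}+\left(24f+60\binom f2\right)t^2(1+t)^f\\&+\left(48\binom f2+192\binom f3\right)t^3(1+t)^{f-2}+192\binom f4\,t^4(1+t)^{f-4}.\end{aligned}$$
   Context: Terms whose coefficient vanishes are $0$ (so negative powers of $1+t$ never actually occur). For $n\ge1$, $\mathfrak B_n$ is the hyperoctahedral group of signed permutations: words $\pi=\pi_1\cdots\pi_n$ of nonzero integers such that $|\pi_1|,\dots,|\pi_n|$ is a permutation of $[n]=\{1,\dots,n\}$, with $\pi(i)=\pi_i$, $\pi(-i)=-\pi(i)$. $\mathcal I_n^B$ is the set of $\pi\in\mathfrak B_n$ with $\pi^2=\mathrm{id}$. With $\pi_0=0$ and the usual order on $\mathbb Z$, $\operatorname{des}^B(\pi)=\#\{0\le i\le n-1:\pi_i>\pi_{i+1}\}$. $\operatorname{fix}_B(\pi)=\#\{i\in[n]:|\pi(i)|=i\}$, and $\operatorname{cyc}_2(\pi)$ is the number of two-cycles of the ordinary involution $i\mapsto|\pi(i)|$ of $[n]$. The polynomial $F_{2,f}$ is the case $j=2$ of $$F_{j,f}(t)=\sum_{\substack{\pi\in\mathcal I_{2j+f}^B\\ \operatorname{cyc}_2(\pi)=j,\ \operatorname{fix}_B(\pi)=f}}t^{\operatorname{des}^B(\pi)}.$$ *)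

theory Defs
  imports "HOL-Computational_Algebra.Polynomial" "HOL-Combinatorics.Permutations"
begin

(* A signed permutation is represented by the function i \<mapsto> \<pi>(i) that the word
   \<pi>\<^sub>1 \<dots> \<pi>\<^sub>n determines: the word consists of the values at 1, ..., n.
   Oddness is the convention \<pi>(-i) = -\<pi>(i), and it forces \<pi>(0) = 0, the convention
   \<pi>\<^sub>0 = 0 used for descents.  The values beyond n are normalised to the identity, so that
   functions and words correspond bijectively.  The letters are nonzero because their
   absolute values lie in {1..n}. *)

definition signed_perms :: "nat \<Rightarrow> (int \<Rightarrow> int) set" where
  "signed_perms n = {\<pi>. bij_betw (\<lambda>i. \<bar>\<pi> i\<bar>) {1..int n} {1..int n}
                       \<and> (\<forall>i. \<pi> (- i) = - \<pi> i)
                       \<and> (\<forall>i > int n. \<pi> i = i)}"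

definition signed_involutions :: "nat \<Rightarrow> (int \<Rightarrow> int) set" where
  "signed_involutions n = {\<pi> \<in> signed_perms n. \<pi> \<circ> \<pi> = id}"

definition des_B :: "nat \<Rightarrow> (int \<Rightarrow> int) \<Rightarrow> nat" where
  "des_B n \<pi> = card {i \<in> {0..int n - 1}. \<pi> i > \<pi> (i + 1)}"

definition fix_B :: "nat \<Rightarrow> (int \<Rightarrow> int) \<Rightarrow> nat" where
  "fix_B n \<pi> = card {i \<in> {1..int n}. \<bar>\<pi> i\<bar> = i}"

(* Each two-cycle {i, j} of i \<mapsto> |\<pi>(i)| is counted once, as the pair with i < j. *)

definition cyc2 :: "nat \<Rightarrow> (int \<Rightarrow> int) \<Rightarrow> nat" where
  "cyc2 n \<pi> = card {(i, j). i \<in> {1..int n} \<and> j \<in> {1..int n} \<and> i < j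
                          \<and> \<bar>\<pi> i\<bar> = j \<and> \<bar>\<pi> j\<bar> = i}"

abbreviation tvar :: "int poly" where
  "tvar \<equiv> [:0, 1:]"

definition F :: "nat \<Rightarrow> nat \<Rightarrow> int poly" where
  "F j f = (\<Sum>\<pi> \<in> {\<pi> \<in> signed_involutions (2 * j + f).
                      cyc2 (2 * j + f) \<pi> = j \<and> fix_B (2 * j + f) \<pi> = f}.
              tvar ^ des_B (2 * j + f) \<pi>)"

(* The sum defining F ranges over a finite set, so it is not the default value 0 of a sum
   over an infinite set. *)

lemma finite_signed_perms: "finite (signed_perms n)"
proof -
  let ?S = "{- int n..int n}"
  have "\<pi> permutes ?S" if p: "\<pi> \<in> signed_perms n" for \<pi>
  proof -
    have bij: "bij_betw (\<lambda>i. \<bar>\<pi> i\<bar>) {1..int n} {1..int n}"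
      and odd: "\<And>i. \<pi> (- i) = - \<pi> i" and out: "\<And>i. i > int n \<Longrightarrow> \<pi> i = i"
      using p by (auto simp: signed_perms_def)
    have zero: "\<pi> 0 = 0" using odd[of 0] by simp
    have abs: "\<bar>\<pi> i\<bar> = \<bar>\<pi> \<bar>i\<bar>\<bar>" for i using odd[of i] by (cases "i \<ge> 0") auto
    have rng: "\<bar>\<pi> i\<bar> \<in> {1..int n}" if "i \<in> {1..int n}" for i
      using bij that by (auto simp: bij_betw_def)
    have outS: "\<pi> i = i" if "i \<notin> ?S" for i
      using out[of i] out[of "- i"] odd[of i] that by force
    have range_S: "\<pi> ` ?S \<subseteq> ?S"
    proof
      fix y assume "y \<in> \<pi> ` ?S"
      then obtain i where i: "i \<in> ?S" "y = \<pi> i" by auto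
      show "y \<in> ?S"
      proof (cases "i = 0")
        case False
        then have "\<bar>i\<bar> \<in> {1..int n}" using i by auto
        from rng[OF this] show ?thesis using abs[of i] i by auto
      qed (use i zero in auto)
    qed
    have "inj_on \<pi> ?S"
    proof (rule inj_onI)
      fix x y assume x: "x \<in> ?S" and y: "y \<in> ?S" and eq: "\<pi> x = \<pi> y"
      show "x = y"
      proof (cases "x = 0 \<or> y = 0")
        case True
        have "z = 0" if "z \<in> ?S" "\<pi> z = 0" for z
          using rng[of "\<bar>z\<bar>"] abs[of z] that by force
        then show ?thesis using True eq zero x y by metis
      next
        case False
        then have "\<bar>x\<bar> \<in> {1..int n}" "\<bar>y\<bar> \<in> {1..int n}" using x y by auto
        moreover have "\<bar>\<pi> \<bar>x\<bar>\<bar> = \<bar>\<pi> \<bar>y\<bar>\<bar>" using eq abs by metis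
        ultimately have xy: "\<bar>x\<bar> = \<bar>y\<bar>" using bij by (auto simp: bij_betw_def inj_on_def)
        have "\<pi> x \<noteq> 0" using rng[OF \<open>\<bar>x\<bar> \<in> _\<close>] abs[of x] by auto
        then have "x \<noteq> - y" using eq odd[of y] by auto
        then show ?thesis using xy by linarith
      qed
    qed
    then have "bij_betw \<pi> ?S ?S"
      using range_S by (simp add: bij_betw_def endo_inj_surj)
    then show ?thesis using outS by (rule bij_imp_permutes)
  qed
  then have "signed_perms n \<subseteq> {\<pi>. \<pi> permutes ?S}" by blast
  then show ?thesis by (rule finite_subset) (simp add: finite_permutations)
qed

end

theory Submission
  imports Defs "HOL-Computational_Algebra.Formal_Power_Series"
begin

text \<open>
  Once the two 2-cycles and their signs are chosen, the signs of the $f$ fixed points are free, and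
  summing $t^{\mathrm{des}}$ over them factors over the five gaps between the four entries
  $a < b < c < d$ of the 2-cycles. Summing over all positions turns this product into a product of
  power series in the gap lengths. Put $q = 1+t$, $Q = 1/(1-qX)$ and $Z = XQ$. A gap with left
  neighbour above and right neighbour below it has series $D$ with $QD = (1+2Z)(1+2tZ)$. With
  $A = 1+2tZ$ and $B = 1+2Z$, the twelve arrangements (three matchings of $a,b,c,d$, four sign
  choices) add up to
  \[ 4t^2Q^3D^2 + Q^2D\,(3tA^2 + 2t^2AB + 3t^3B^2) = 3tQ\,AB\,(A+tB)^2, \qquad A + tB = q + 4tZ, \]
  and expanding in the series $QZ^k = \sum_f \binom{f}{k} q^{f-k} X^f$ gives the formula.
\<close>

section \<open>Descent enumeration along runs of fixed points of free sign\<close>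

text \<open>The descent enumerator of the words filling positions $p+1,\dots,p+k$ with letters
  $x_i \in A_i$ and preceded by the letter $u$.\<close>

primrec wsum :: "'a::comm_semiring_1 \<Rightarrow> (int \<Rightarrow> int set) \<Rightarrow> int \<Rightarrow> nat \<Rightarrow> int \<Rightarrow> 'a" where
  "wsum t A p 0 u = 1"
| "wsum t A p (Suc k) u = (\<Sum>x\<in>A (p + 1). t ^ of_bool (x < u) * wsum t A (p + 1) k x)"

text \<open>The same for a run of $g$ fixed points of free sign at positions $p+1,\dots,p+g$ between the
  letters $u$ and $v$. Its value depends on $u$, $v$ only through their signs and through whether
  their absolute values lie below or above all positions of the run, except that the empty run
  compares $u$ with $v$ directly.\<close>

primrec run_sum :: "'a::comm_semiring_1 \<Rightarrow> int \<Rightarrow> nat \<Rightarrow> int \<Rightarrow> int \<Rightarrow> 'a" where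
  "run_sum t p 0 u v = t ^ of_bool (v < u)"
| "run_sum t p (Suc g) u v =
     (\<Sum>x\<in>{p + 1, - (p + 1)}. t ^ of_bool (x < u) * run_sum t (p + 1) g x v)"

text \<open>The letter at \<open>q\<close> is forced to be \<open>v\<close>, so the weight of what
  follows is the same for all letters of the run and factors out.\<close>

lemma wsum_run:
  assumes "q = p + int g + 1" "\<And>x. p < x \<Longrightarrow> x < q \<Longrightarrow> A x = {x, - x}" "A q = {v}"
  shows "wsum t A p (g + Suc k) u = run_sum t p g u v * wsum t A q k v"
  using assms
proof (induction g arbitrary: p u)
  case 0
  then show ?case by simp
next
  case (Suc g)
  have "A (p + 1) = {p + 1, - (p + 1)}" using Suc.prems by simp
  moreover have "wsum t A (p + 1) (g + Suc k) x = run_sum t (p + 1) g x v * wsum t A q k v" for x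
    using Suc.prems by (intro Suc.IH) simp_all
  ultimately show ?case
    by (simp del: sum.insert add: sum_distrib_right mult.assoc)
qed

text \<open>As \<open>u\<close> is smaller in absolute value than the new letter, there is a descent
  exactly for the negative sign; hence \<open>1 + t\<close>.\<close>

lemma sum_signs_small:
  fixes p u :: int
  assumes "\<bar>u\<bar> \<le> p" "\<And>x. \<bar>x\<bar> \<le> p + 1 \<Longrightarrow> h x = c"
  shows "(\<Sum>x\<in>{p + 1, - (p + 1)}. t ^ of_bool (x < u) * h x) = (1 + t) * (c :: 'a::comm_semiring_1)"
proof -
  have "p + 1 \<noteq> - (p + 1)" "\<not> p + 1 < u" using assms(1) by auto
  moreover have "t ^ of_bool (- (p + 1) < u) * h (- (p + 1)) = t * c"
    using assms by (subst assms(2)) auto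
  moreover have "h (p + 1) = c" using assms by auto
  ultimately show ?thesis by (simp add: distrib_right)
qed

text \<open>The size of \<open>u\<close> dominates: both signs of the letter compare with
  \<open>u\<close> in the same way, decided by the sign of \<open>u\<close>.\<close>

lemma sum_signs_big:
  fixes p u :: int
  assumes "0 \<le> p" "p + 1 < \<bar>u\<bar>" "\<And>x. \<bar>x\<bar> \<le> p + 1 \<Longrightarrow> h x = c"
  shows "(\<Sum>x\<in>{p + 1, - (p + 1)}. t ^ of_bool (x < u) * h x)
    = 2 * t ^ of_bool (0 < u) * (c :: 'a::comm_semiring_1)"
proof -
  have "p + 1 \<noteq> - (p + 1)" using assms(1) by linarith
  moreover have "h (- (p + 1)) = c" "h (p + 1) = c" using assms by auto
  moreover have "(p + 1 < u) = (0 < u)" "(- (p + 1) < u) = (0 < u)" using assms by auto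
  ultimately have "(\<Sum>x\<in>{p + 1, - (p + 1)}. t ^ of_bool (x < u) * h x)
      = t ^ of_bool (0 < u) * c + t ^ of_bool (0 < u) * c"
    by (simp only: sum.insert finite.intros empty_iff insert_iff sum.empty add_0_right simp_thms if_False)
  then show ?thesis by (simp only: mult_2 distrib_right)
qed

lemma wsum_final_run:
  assumes "\<And>x. p < x \<Longrightarrow> x \<le> p + int k \<Longrightarrow> A x = {x, - x}" "\<bar>u\<bar> \<le> p"
  shows "wsum t A p k u = (1 + t) ^ k"
  using assms
proof (induction k arbitrary: p u)
  case (Suc k)
  have "A (p + 1) = {p + 1, - (p + 1)}" using Suc.prems(1)[of "p + 1"] by simp
  moreover have "wsum t A (p + 1) k x = (1 + t) ^ k" if "\<bar>x\<bar> \<le> p + 1" for x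
    using Suc.prems that by (intro Suc.IH) auto
  ultimately show ?case
    using sum_signs_small[where h = "wsum t A (p + 1) k", OF Suc.prems(2)] by simp
qed simp

text \<open>Absolute values increase all the way from \<open>u\<close> to \<open>v\<close>, so a
  step is a descent exactly when the new letter is negative.\<close>

lemma run_sum_small_big:
  assumes "\<bar>u\<bar> \<le> p" "p + int g < \<bar>v\<bar>"
  shows "run_sum t p g u v = t ^ of_bool (v < 0) * (1 + t) ^ g"
  using assms
proof (induction g arbitrary: p u)
  case 0
  then have "(v < u) = (v < 0)" by auto
  then show ?case by simp
next
  case (Suc g)
  have "run_sum t (p + 1) g x v = t ^ of_bool (v < 0) * (1 + t) ^ g" if "\<bar>x\<bar> \<le> p + 1" for x
    using Suc.prems that by (intro Suc.IH) auto
  from sum_signs_small[where h = "\<lambda>x. run_sum t (p + 1) g x v", OF Suc.prems(1) this] show ?case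
    by (simp add: mult_ac)
qed

text \<open>The last letter exceeds both its neighbours in absolute value, so either sign gives
  exactly one descent there: after it if positive, before it if negative. This is the factor
  \<open>2 * t\<close>; each earlier letter gives \<open>1 + t\<close>.\<close>

lemma run_sum_small_small:
  assumes "\<bar>u\<bar> \<le> p" "\<bar>v\<bar> \<le> p"
  shows "run_sum t p (Suc g) u v = 2 * t * (1 + t) ^ g"
  using assms
proof (induction g arbitrary: p u)
  case 0
  then have "p + 1 \<noteq> - (p + 1)" "\<not> p + 1 < u" "- (p + 1) < u" "v < p + 1" "\<not> v < - (p + 1)"
    by auto
  then have "run_sum t p (Suc 0) u v = t + t" by simp
  then show ?case by (simp only: mult_2 distrib_right power_0 mult_1_right)
next
  case (Suc g)
  have "run_sum t (p + 1) (Suc g) x v = 2 * t * (1 + t) ^ g" if "\<bar>x\<bar> \<le> p + 1" for x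
    using Suc.prems that by (intro Suc.IH) auto
  from sum_signs_small[where h = "\<lambda>x. run_sum t (p + 1) (Suc g) x v", OF Suc.prems(1) this] show ?case
    by (simp only: run_sum.simps(2)[of t p "Suc g"] power_Suc mult_ac)
qed

lemma run_sum_big_big:
  assumes "0 \<le> p" "p + int (Suc g) < \<bar>u\<bar>" "p + int (Suc g) < \<bar>v\<bar>"
  shows "run_sum t p (Suc g) u v = 2 * t ^ (of_bool (0 < u) + of_bool (v < 0)) * (1 + t) ^ g"
proof -
  have "run_sum t (p + 1) g x v = t ^ of_bool (v < 0) * (1 + t) ^ g" if "\<bar>x\<bar> \<le> p + 1" for x
    using assms that by (intro run_sum_small_big) auto
  from sum_signs_big[where h = "\<lambda>x. run_sum t (p + 1) g x v", OF assms(1) _ this, where u = u and t = t] show ?thesis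
    using assms by (simp add: power_add mult_ac)
qed

text \<open>The two signs of the first letter look alike from \<open>u\<close>. If the run ends
  there, they differ in the comparison with \<open>v\<close>, which gives \<open>1 + t\<close>;
  otherwise the remaining run gives \<open>2 * t * (1 + t) ^ h\<close> for either sign.\<close>

lemma run_sum_big_small:
  assumes "0 \<le> p" "p + int (Suc g) < \<bar>u\<bar>" "\<bar>v\<bar> \<le> p"
  shows "run_sum t p (Suc g) u v =
    t ^ of_bool (0 < u) * (case g of 0 \<Rightarrow> 1 + t | Suc h \<Rightarrow> 4 * t * (1 + t) ^ h)"
proof (cases g)
  case 0
  have "p + 1 \<noteq> - (p + 1)" "(p + 1 < u) = (0 < u)" "(- (p + 1) < u) = (0 < u)"
    "v < p + 1" "\<not> v < - (p + 1)"
    using assms 0 by auto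
  then have "run_sum t p (Suc 0) u v = t ^ of_bool (0 < u) * t + t ^ of_bool (0 < u)" by simp
  then show ?thesis by (simp add: 0 distrib_left add.commute)
next
  case (Suc h)
  have "run_sum t (p + 1) g x v = 2 * t * (1 + t) ^ h" if "\<bar>x\<bar> \<le> p + 1" for x
    unfolding Suc using assms that by (intro run_sum_small_small) auto
  from sum_signs_big[where h = "\<lambda>x. run_sum t (p + 1) g x v", OF assms(1) _ this, where u = u and t = t]
  have "run_sum t p (Suc g) u v = 2 * t ^ of_bool (0 < u) * (2 * t * (1 + t) ^ h)"
    using assms by simp
  also have "\<dots> = t ^ of_bool (0 < u) * ((2 * 2) * t * (1 + t) ^ h)"
    by (simp only: mult_ac)
  finally show ?thesis by (simp add: Suc)
qed

text \<open>\<open>wsum_run\<close> splits the word at each of the four forced letters; the bound on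
  \<open>vd\<close> lets \<open>wsum_final_run\<close> treat what follows \<open>d\<close>.\<close>

lemma wsum_four_entries:
  assumes "\<And>x. x \<in> {1..int (g0 + g1 + g2 + g3 + g4 + 4)} - {a, b, c, d} \<Longrightarrow> A x = {x, - x}"
    and pos: "a = int g0 + 1" "b = a + int g1 + 1" "c = b + int g2 + 1" "d = c + int g3 + 1"
    and A: "A a = {va}" "A b = {vb}" "A c = {vc}" "A d = {vd}" and "\<bar>vd\<bar> \<le> d"
  shows "wsum t A 0 (g0 + g1 + g2 + g3 + g4 + 4) 0 =
    run_sum t 0 g0 0 va * run_sum t a g1 va vb * run_sum t b g2 vb vc * run_sum t c g3 vc vd
      * (1 + t) ^ g4"
proof -
  have free: "A x = {x, - x}"
    if "0 < x \<and> x < a \<or> a < x \<and> x < b \<or> b < x \<and> x < c \<or> c < x \<and> x < d \<or> d < x \<and> x \<le> d + int g4" for x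
  proof (rule assms(1))
    show "x \<in> {1..int (g0 + g1 + g2 + g3 + g4 + 4)} - {a, b, c, d}"
      using that pos by auto
  qed
  have "wsum t A 0 (g0 + Suc (g1 + Suc (g2 + Suc (g3 + Suc g4)))) 0
      = run_sum t 0 g0 0 va * wsum t A a (g1 + Suc (g2 + Suc (g3 + Suc g4))) va"
    by (rule wsum_run[OF _ free A(1)]) (simp_all add: pos(1))
  also have "wsum t A a (g1 + Suc (g2 + Suc (g3 + Suc g4))) va
      = run_sum t a g1 va vb * wsum t A b (g2 + Suc (g3 + Suc g4)) vb"
    by (rule wsum_run[OF pos(2) free A(2)]) simp
  also have "wsum t A b (g2 + Suc (g3 + Suc g4)) vb
      = run_sum t b g2 vb vc * wsum t A c (g3 + Suc g4) vc"
    by (rule wsum_run[OF pos(3) free A(3)]) simp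
  also have "wsum t A c (g3 + Suc g4) vc = run_sum t c g3 vc vd * wsum t A d g4 vd"
    by (rule wsum_run[OF pos(4) free A(4)]) simp
  also have "wsum t A d g4 vd = (1 + t) ^ g4"
    using assms(10) by (intro wsum_final_run free) simp_all
  also have "g0 + Suc (g1 + Suc (g2 + Suc (g3 + Suc g4))) = g0 + g1 + g2 + g3 + g4 + 4"
    by simp
  finally show ?thesis by (simp only: mult.assoc)
qed

section \<open>Signed permutations as words\<close>

text \<open>The normalisation is that of \<open>signed_perms\<close>, with a set of allowed letters
  at each position in place of bijectivity, so that letters are chosen independently.\<close>

definition signed_maps :: "nat \<Rightarrow> (int \<Rightarrow> int set) \<Rightarrow> (int \<Rightarrow> int) set" where
  "signed_maps n A = {\<pi>. (\<forall>i. \<pi> (- i) = - \<pi> i) \<and> (\<forall>i > int n. \<pi> i = i)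
                        \<and> (\<forall>i\<in>{1..int n}. \<pi> i \<in> A i)}"

primrec descents :: "int \<Rightarrow> int list \<Rightarrow> nat" where
  "descents u [] = 0"
| "descents u (x # xs) = of_bool (x < u) + descents x xs"

lemma mem_listset_iff: "xs \<in> listset As \<longleftrightarrow> list_all2 (\<in>) xs As"
  by (induction As arbitrary: xs) (auto simp: set_Cons_def list_all2_Cons2)

lemma upto_Suc_eq: "[p + 1..p + int (Suc k)] = (p + 1) # [p + 1 + 1..p + 1 + int k]"
  by (simp add: upto_rec1 algebra_simps)

lemma sum_descents_listset:
  "(\<Sum>xs\<in>listset (map A [p + 1..p + int k]). t ^ descents u xs) = wsum t A p k u"
proof (induction k arbitrary: p u)
  case (Suc k)
  let ?L = "listset (map A [p + 1 + 1..p + 1 + int k])"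
  have "listset (map A [p + 1..p + int (Suc k)]) = (\<lambda>(x, xs). x # xs) ` (A (p + 1) \<times> ?L)"
    unfolding upto_Suc_eq by (auto simp: set_Cons_def)
  moreover have "inj_on (\<lambda>(x, xs). x # xs) (A (p + 1) \<times> ?L)"
    by (auto simp: inj_on_def)
  ultimately have "(\<Sum>xs\<in>listset (map A [p + 1..p + int (Suc k)]). t ^ descents u xs)
      = (\<Sum>(x, xs)\<in>A (p + 1) \<times> ?L. t ^ of_bool (x < u) * t ^ descents x xs)"
    by (simp only: sum.reindex) (auto intro!: sum.cong simp: power_add)
  also have "\<dots> = (\<Sum>x\<in>A (p + 1). t ^ of_bool (x < u) * (\<Sum>xs\<in>?L. t ^ descents x xs))"
    by (simp only: sum.cartesian_product[symmetric] sum_distrib_left)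
  finally show ?case by (simp only: Suc.IH wsum.simps)
qed simp

lemma descents_map_upto:
  "descents (\<pi> p) (map \<pi> [p + 1..p + int k]) = card {i \<in> {p..p + int k - 1}. \<pi> (i + 1) < \<pi> i}"
proof (induction k arbitrary: p)
  case (Suc k)
  let ?S = "{i \<in> {p + 1..p + 1 + int k - 1}. \<pi> (i + 1) < \<pi> i}"
  have "{i \<in> {p..p + int (Suc k) - 1}. \<pi> (i + 1) < \<pi> i} = (if \<pi> (p + 1) < \<pi> p then {p} else {}) \<union> ?S"
    by (auto simp: order_le_less)
  moreover have "finite ?S" "p \<notin> ?S" by (rule finite_subset[of _ "{p + 1..p + 1 + int k - 1}"]) auto
  ultimately have "card {i \<in> {p..p + int (Suc k) - 1}. \<pi> (i + 1) < \<pi> i}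
      = of_bool (\<pi> (p + 1) < \<pi> p) + card ?S"
    by (simp only:) (auto split: if_splits)
  then show ?case
    unfolding upto_Suc_eq by (simp only: list.map descents.simps Suc.IH)
qed simp

text \<open>Oddness fixes the values at 0 and at negative arguments, the normalisation those beyond
  \<open>n\<close>; what remains is an arbitrary word.\<close>

lemma bij_betw_signed_maps_listset:
  "bij_betw (\<lambda>\<pi>. map \<pi> [1..int n]) (signed_maps n A) (listset (map A [1..int n]))"
  unfolding bij_betw_def
proof
  show "inj_on (\<lambda>\<pi>. map \<pi> [1..int n]) (signed_maps n A)"
  proof (rule inj_onI)
    fix \<pi> \<rho> assume \<pi>: "\<pi> \<in> signed_maps n A" and \<rho>: "\<rho> \<in> signed_maps n A"
      and "map \<pi> [1..int n] = map \<rho> [1..int n]"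
    then have "\<pi> x = \<rho> x" if "x \<in> {1..int n}" for x using that by simp
    moreover have "\<pi> x = \<rho> x" if "x > int n" for x using \<pi> \<rho> that by (simp add: signed_maps_def)
    ultimately have pos: "\<pi> x = \<rho> x" if "x > 0" for x using that by (cases "x \<le> int n") simp_all
    have odd: "\<pi> (- x) = - \<pi> x" "\<rho> (- x) = - \<rho> x" for x using \<pi> \<rho> by (simp_all add: signed_maps_def)
    show "\<pi> = \<rho>"
    proof
      fix x show "\<pi> x = \<rho> x"
        using pos[of x] pos[of "- x"] odd[of x] odd[of 0] by (cases "x < 0"; cases "x = 0") simp_all
    qed
  qed
next
  show "(\<lambda>\<pi>. map \<pi> [1..int n]) ` signed_maps n A = listset (map A [1..int n])"
  proof (intro equalityI subsetI)
    fix xs assume "xs \<in> (\<lambda>\<pi>. map \<pi> [1..int n]) ` signed_maps n A"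
    then show "xs \<in> listset (map A [1..int n])"
      by (auto simp: mem_listset_iff list_all2_conv_all_nth signed_maps_def)
  next
    fix xs assume "xs \<in> listset (map A [1..int n])"
    then have len: "length xs = n" and "\<forall>i<n. xs ! i \<in> A (1 + int i)"
      by (auto simp: mem_listset_iff list_all2_conv_all_nth)
    have xs: "xs ! nat (i - 1) \<in> A i" if "1 \<le> i" "i \<le> int n" for i
      using \<open>\<forall>i<n. _\<close>[rule_format, of "nat (i - 1)"] that by simp
    define h where "h x = (if 1 \<le> x \<and> x \<le> int n then xs ! nat (x - 1) else x)" for x :: int
    \<comment> \<open>At 0 the second branch applies and \<open>h 0 = 0\<close>, so
      \<open>\<pi> 0 = 0\<close> as oddness requires.\<close>
    define \<pi> where "\<pi> x = (if x > 0 then h x else - h (- x))" for x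
    have "\<pi> \<in> signed_maps n A"
      using xs by (auto simp: signed_maps_def \<pi>_def h_def)
    moreover have "map \<pi> [1..int n] = xs"
      using len by (intro nth_equalityI) (auto simp: \<pi>_def h_def)
    ultimately show "xs \<in> (\<lambda>\<pi>. map \<pi> [1..int n]) ` signed_maps n A" by force
  qed
qed

lemma sum_des_B_signed_maps:
  "(\<Sum>\<pi>\<in>signed_maps n A. t ^ des_B n \<pi>) = wsum t A 0 n 0"
proof -
  have "des_B n \<pi> = descents 0 (map \<pi> [1..int n])" if "\<pi> \<in> signed_maps n A" for \<pi>
  proof -
    have "\<pi> (- 0) = - \<pi> 0" using that unfolding signed_maps_def by blast
    then have "\<pi> 0 = 0" by simp
    then show ?thesis using descents_map_upto[of \<pi> 0 n] by (simp add: des_B_def)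
  qed
  then have "(\<Sum>\<pi>\<in>signed_maps n A. t ^ des_B n \<pi>)
      = (\<Sum>\<pi>\<in>signed_maps n A. t ^ descents 0 (map \<pi> [1..int n]))"
    by simp
  also have "\<dots> = (\<Sum>xs\<in>listset (map A [1..int n]). t ^ descents 0 xs)"
    by (rule sum.reindex_bij_betw[OF bij_betw_signed_maps_listset])
  also have "\<dots> = wsum t A 0 n 0"
    using sum_descents_listset[of t 0 A 0 n] by simp
  finally show ?thesis .
qed

section \<open>Power series of the gap weights\<close>

unbundle fps_syntax

context
  fixes t :: "'a::comm_ring_1"
begin

text \<open>This is \<open>Q = 1 / (1 - (1 + t) X)\<close>, given by its coefficients over an
  arbitrary commutative ring; \<open>geo_eq\<close> stands in for the division.\<close>

definition geo :: "'a fps" where "geo = Abs_fps (\<lambda>n. (1 + t) ^ n)"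

lemma geo_eq: "geo = 1 + fps_const (1 + t) * fps_X * geo"
proof (rule fps_ext)
  fix n
  show "geo $ n = (1 + fps_const (1 + t) * fps_X * geo) $ n"
    by (cases n) (simp_all add: geo_def mult.assoc del: fps_const_add)
qed

text \<open>By Pascal's rule, multiplying the series for \<open>Suc k\<close> by
  \<open>1 - (1 + t) X\<close> gives \<open>X\<close> times the series for \<open>k\<close>;
  \<open>geo\<close> inverts that factor.\<close>

lemma fps_binomial_power:
  "Abs_fps (\<lambda>n. of_nat (n choose k) * (1 + t) ^ (n - k)) = geo * (fps_X * geo) ^ k"
proof (induction k)
  case 0
  show ?case by (simp add: geo_def)
next
  case (Suc k)
  define G where "G k = Abs_fps (\<lambda>n. of_nat (n choose k) * (1 + t) ^ (n - k))" for k
  have "(G (Suc k) - fps_const (1 + t) * (fps_X * G (Suc k))) $ n = (fps_X * G k) $ n" for n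
  proof (cases n)
    case (Suc m)
    show ?thesis
    proof (cases "m \<le> k")
      \<comment> \<open>The exponent \<open>m - Suc k\<close> is truncated here, but its coefficient
        \<open>m choose Suc k\<close> is 0.\<close>
      case True
      then show ?thesis using Suc by (auto simp: G_def le_less binomial_eq_0)
    next
      case False
      then have "m - k = Suc (m - Suc k)" by simp
      then show ?thesis using Suc
        by (simp add: G_def algebra_simps)
    qed
  qed (simp add: G_def)
  then have "G (Suc k) - fps_const (1 + t) * (fps_X * G (Suc k)) = fps_X * G k"
    by (simp add: fps_eq_iff)
  moreover have "G (Suc k) = geo * (G (Suc k) - fps_const (1 + t) * (fps_X * G (Suc k)))"
  proof -
    have "geo * (G (Suc k) - fps_const (1 + t) * (fps_X * G (Suc k)))
        = (geo - fps_const (1 + t) * fps_X * geo) * G (Suc k)"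
      by (simp only: algebra_simps)
    also have "geo - fps_const (1 + t) * fps_X * geo = 1"
      using geo_eq by (simp add: algebra_simps)
    finally show ?thesis by simp
  qed
  ultimately have "G (Suc k) = geo * (fps_X * G k)" by simp
  then show ?case by (simp add: Suc.IH G_def mult_ac)
qed

text \<open>Weights of a gap of $g$ fixed points whose two neighbours have absolute values on the same side
  of the gap (both above or both below its positions), and of one with the left neighbour above and
  the right one below; a factor depending only on the sign of the left neighbour is split off from
  the latter.\<close>

definition gap_same :: "nat \<Rightarrow> nat \<Rightarrow> nat \<Rightarrow> 'a" where
  "gap_same e h g = (case g of 0 \<Rightarrow> t ^ e | Suc k \<Rightarrow> 2 * t ^ h * (1 + t) ^ k)"

definition gap_cross :: "nat \<Rightarrow> 'a" where
  "gap_cross g = (case g of 0 \<Rightarrow> 1 | Suc 0 \<Rightarrow> 1 + t | Suc (Suc k) \<Rightarrow> 4 * t * (1 + t) ^ k)"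

lemma fps_gap_same:
  "Abs_fps (gap_same e h) = fps_const t ^ e + 2 * fps_const t ^ h * (fps_X * geo)"
proof (rule fps_ext)
  fix n
  show "Abs_fps (gap_same e h) $ n = (fps_const t ^ e + 2 * fps_const t ^ h * (fps_X * geo)) $ n"
    by (cases n) (simp_all add: gap_same_def geo_def fps_const_power numeral_fps_const mult.assoc
        del: fps_const_add flip: fps_const_mult)
qed

text \<open>With \<open>Z = X * geo\<close> the product is \<open>geo + (1 + t) Z + 4 t Z^2\<close>.
  Substituting \<open>geo = 1 + (1 + t) Z\<close> leaves \<open>1 + 2 (1 + t) Z + 4 t Z^2\<close>,
  which factors.\<close>

lemma geo_fps_gap_cross:
  "geo * Abs_fps gap_cross = (1 + 2 * (fps_X * geo)) * (1 + 2 * fps_const t * (fps_X * geo))"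
proof -
  have "Abs_fps gap_cross = 1 + fps_const (1 + t) * fps_X + 4 * fps_const t * fps_X * (fps_X * geo)"
  proof (rule fps_ext)
    fix n
    show "Abs_fps gap_cross $ n
        = (1 + fps_const (1 + t) * fps_X + 4 * fps_const t * fps_X * (fps_X * geo)) $ n"
      by (cases n; cases "n - 1") (simp_all add: gap_cross_def geo_def numeral_fps_const mult.assoc
        del: fps_const_add flip: fps_const_mult)
  qed
  then have "geo * Abs_fps gap_cross
      = geo + fps_const (1 + t) * (fps_X * geo) + 4 * fps_const t * (fps_X * geo)\<^sup>2"
    by (simp add: algebra_simps power2_eq_square del: fps_const_add)
  moreover
  \<comment> \<open>The variable \<open>z\<close> hides the \<open>geo\<close> inside
    \<open>X * geo\<close>, so that only the isolated one is rewritten.\<close>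
  have "geo + fps_const (1 + t) * z + 4 * fps_const t * z\<^sup>2
      = (1 + 2 * z) * (1 + 2 * fps_const t * z)" if "geo = 1 + fps_const (1 + t) * z" for z
    unfolding that by (simp add: algebra_simps power2_eq_square flip: fps_const_add)
  from this[OF geo_eq[unfolded mult.assoc]]
  have "geo + fps_const (1 + t) * (fps_X * geo) + 4 * fps_const t * (fps_X * geo)\<^sup>2
      = (1 + 2 * (fps_X * geo)) * (1 + 2 * fps_const t * (fps_X * geo))" .
  ultimately show ?thesis by (rule trans)
qed

end

text \<open>Write \<open>A = 1 + 2 T Z\<close> and \<open>B = 1 + 2 Z\<close>. Once
  \<open>Q * D\<close> is replaced by \<open>A B\<close>, the coefficient of \<open>T^2 A B\<close>
  in the second factor becomes 4 + 2 = 6, which completes the square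
  \<open>3 T (A + T B)^2\<close>.\<close>

lemma generating_function_identity:
  fixes T Q Z D :: "'a::comm_ring_1"
  defines "q \<equiv> 1 + T"
  assumes "Q * D = (1 + 2 * Z) * (1 + 2 * T * Z)"
  shows "4 * T\<^sup>2 * Q ^ 3 * D\<^sup>2
      + Q\<^sup>2 * D * (3 * T * (1 + 2 * T * Z)\<^sup>2 + 2 * T\<^sup>2 * (1 + 2 * T * Z) * (1 + 2 * Z) + 3 * T ^ 3 * (1 + 2 * Z)\<^sup>2)
    = Q * (3 * T * q\<^sup>2 + 6 * T * q ^ 3 * Z + 24 * T\<^sup>2 * q * Z + 60 * T\<^sup>2 * q\<^sup>2 * Z\<^sup>2
        + 48 * T ^ 3 * Z\<^sup>2 + 192 * T ^ 3 * q * Z ^ 3 + 192 * T ^ 4 * Z ^ 4)"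
proof -
  let ?A = "1 + 2 * T * Z" and ?B = "1 + 2 * Z"
  have "4 * T\<^sup>2 * Q ^ 3 * D\<^sup>2 + Q\<^sup>2 * D * (3 * T * ?A\<^sup>2 + 2 * T\<^sup>2 * ?A * ?B + 3 * T ^ 3 * ?B\<^sup>2)
      = Q * (4 * T\<^sup>2 * (Q * D)\<^sup>2 + (Q * D) * (3 * T * ?A\<^sup>2 + 2 * T\<^sup>2 * ?A * ?B + 3 * T ^ 3 * ?B\<^sup>2))"
    by (simp add: algebra_simps power2_eq_square power3_eq_cube)
  also have "\<dots> = Q * (3 * T * (?B * ?A) * (?A + T * ?B)\<^sup>2)"
    unfolding assms(2) by (simp add: algebra_simps power2_eq_square power3_eq_cube)
  also have "\<dots> = Q * (3 * T * q\<^sup>2 + 6 * T * q ^ 3 * Z + 24 * T\<^sup>2 * q * Z + 60 * T\<^sup>2 * q\<^sup>2 * Z\<^sup>2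
        + 48 * T ^ 3 * Z\<^sup>2 + 192 * T ^ 3 * q * Z ^ 3 + 192 * T ^ 4 * Z ^ 4)"
    unfolding q_def by (simp add: algebra_simps power2_eq_square power3_eq_cube power4_eq_xxxx)
  finally show ?thesis .
qed

section \<open>Involutions with two 2-cycles, classified by arcs and signs\<close>

definition signs :: "int set" where "signs = {1, - 1}"

text \<open>The condition $i < k$ lists the two 2-cycles $\{i,j\}$, $\{k,l\}$ in a canonical order.\<close>

definition arc_pairs :: "nat \<Rightarrow> (int \<times> int \<times> int \<times> int) set" where
  "arc_pairs n = {(i, j, k, l). 0 < i \<and> i < j \<and> j \<le> int n \<and> k < l \<and> l \<le> int n
                              \<and> i < k \<and> j \<noteq> k \<and> j \<noteq> l}"

text \<open>One sign per 2-cycle suffices: in an involution \<open>\<pi> i = s * j\<close> forces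
  \<open>\<pi> j = s * i\<close>.\<close>

fun arc_values :: "int \<times> int \<times> int \<times> int \<Rightarrow> int \<times> int \<Rightarrow> int \<Rightarrow> int set" where
  "arc_values (i, j, k, l) (s, s') x =
     (if x = i then {s * j} else if x = j then {s * i}
      else if x = k then {s' * l} else if x = l then {s' * k} else {x, - x})"

definition two_cycles :: "nat \<Rightarrow> (int \<Rightarrow> int) \<Rightarrow> (int \<times> int) set" where
  "two_cycles n \<pi> = {(i, j). i \<in> {1..int n} \<and> j \<in> {1..int n} \<and> i < j
                          \<and> \<bar>\<pi> i\<bar> = j \<and> \<bar>\<pi> j\<bar> = i}"

definition arc_maps :: "nat \<Rightarrow> int \<times> int \<times> int \<times> int \<Rightarrow> int \<times> int \<Rightarrow> (int \<Rightarrow> int) set" where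
  "arc_maps n p \<epsilon> = signed_maps n (arc_values p \<epsilon>)"

lemma arc_map_values:
  assumes "(i, j, k, l) \<in> arc_pairs n" "s \<in> signs" "s' \<in> signs" "\<pi> \<in> arc_maps n (i, j, k, l) (s, s')"
  shows "\<pi> i = s * j" "\<pi> j = s * i" "\<pi> k = s' * l" "\<pi> l = s' * k"
    "\<And>x. x \<in> {1..int n} - {i, j, k, l} \<Longrightarrow> \<bar>\<pi> x\<bar> = x"
proof -
  have A: "\<pi> x \<in> arc_values (i, j, k, l) (s, s') x" if "x \<in> {1..int n}" for x
    using assms(4) that by (simp add: arc_maps_def signed_maps_def)
  show "\<pi> i = s * j" "\<pi> j = s * i" "\<pi> k = s' * l" "\<pi> l = s' * k"
    using A[of i] A[of j] A[of k] A[of l] assms(1) by (auto simp: arc_pairs_def)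
  show "\<bar>\<pi> x\<bar> = x" if "x \<in> {1..int n} - {i, j, k, l}" for x
    using A[of x] that by auto
qed

text \<open>Other positions are fixed up to sign and lie in no 2-cycle. Hence \<open>\<pi>\<close>
  determines its arcs, which later makes the classes disjoint.\<close>

lemma two_cycles_arc_map:
  assumes "(i, j, k, l) \<in> arc_pairs n" "s \<in> signs" "s' \<in> signs" "\<pi> \<in> arc_maps n (i, j, k, l) (s, s')"
  shows "two_cycles n \<pi> = {(i, j), (k, l)}"
proof -
  note v = arc_map_values[OF assms]
  have abs: "\<bar>\<pi> i\<bar> = j" "\<bar>\<pi> j\<bar> = i" "\<bar>\<pi> k\<bar> = l" "\<bar>\<pi> l\<bar> = k"
    using v(1-4) assms(1-3) by (auto simp: arc_pairs_def signs_def)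
  have idx: "i < j" "k < l" using assms(1) by (auto simp: arc_pairs_def)
  have "two_cycles n \<pi> \<subseteq> {(i, j), (k, l)}"
  proof (rule subrelI)
    fix x y assume "(x, y) \<in> two_cycles n \<pi>"
    then have x: "x \<in> {1..int n}" "x < y" "\<bar>\<pi> x\<bar> = y" by (auto simp: two_cycles_def)
    then have "x \<in> {i, j, k, l}" using v(5)[of x] by (metis DiffI less_irrefl)
    then show "(x, y) \<in> {(i, j), (k, l)}"
      using x abs idx by (elim insertE emptyE) simp_all
  qed
  moreover have "{(i, j), (k, l)} \<subseteq> two_cycles n \<pi>"
    using abs assms(1) by (auto simp: two_cycles_def arc_pairs_def)
  ultimately show ?thesis by blast
qed

lemma arc_maps_subset:
  assumes "(i, j, k, l) \<in> arc_pairs (4 + f)" "s \<in> signs" "s' \<in> signs"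
    and \<pi>: "\<pi> \<in> arc_maps (4 + f) (i, j, k, l) (s, s')"
  shows "\<pi> \<in> signed_involutions (4 + f) \<and> cyc2 (4 + f) \<pi> = 2 \<and> fix_B (4 + f) \<pi> = f"
proof -
  define n where "n = 4 + f"
  note v = arc_map_values[OF assms, folded n_def]
  have odd: "\<pi> (- x) = - \<pi> x" and out: "x > int n \<Longrightarrow> \<pi> x = x" for x
    using \<pi> unfolding n_def by (simp_all add: arc_maps_def signed_maps_def)
  have idx: "0 < i" "i < j" "j \<le> int n" "k < l" "l \<le> int n" "i < k" "j \<noteq> k" "j \<noteq> l"
    using assms(1) unfolding n_def by (auto simp: arc_pairs_def)
  have abs: "\<bar>\<pi> i\<bar> = j" "\<bar>\<pi> j\<bar> = i" "\<bar>\<pi> k\<bar> = l" "\<bar>\<pi> l\<bar> = k"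
    using v(1-4) assms(2,3) idx by (auto simp: signs_def)
  have pos: "\<pi> (\<pi> x) = x" if "x \<in> {1..int n}" for x
  proof (cases "x \<in> {i, j, k, l}")
    case True
    then show ?thesis
      using v(1-4) odd[of i] odd[of j] odd[of k] odd[of l] assms(2,3) by (auto simp: signs_def)
  next
    case False
    then have "\<pi> x = x \<or> \<pi> x = - x" using v(5)[of x] that by auto
    then show ?thesis using odd[of x] by auto
  qed
  have "\<pi> (\<pi> x) = x" for x
  proof -
    have "\<pi> (\<pi> x) = x" if "x > 0" for x
      using that pos[of x] out[of x] by (cases "x \<le> int n") simp_all
    moreover have "\<pi> 0 = 0" using odd[of 0] by simp
    moreover have "\<pi> (\<pi> (- x)) = - \<pi> (\<pi> x)" using odd by metis
    ultimately show ?thesis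
      by (metis add.inverse_inverse linorder_neqE_linordered_idom neg_0_less_iff_less odd)
  qed
  then have inv: "\<pi> \<circ> \<pi> = id" by auto
  have range: "\<bar>\<pi> x\<bar> \<in> {1..int n}" if x: "x \<in> {1..int n}" for x
  proof -
    consider "x = i" | "x = j" | "x = k" | "x = l" | "x \<in> {1..int n} - {i, j, k, l}" using x by blast
    then show ?thesis by cases (simp_all only: abs v(5), use x idx in auto)
  qed
  have absabs: "\<bar>\<pi> \<bar>\<pi> x\<bar>\<bar> = x" if x: "x \<in> {1..int n}" for x
  proof -
    consider "x = i" | "x = j" | "x = k" | "x = l" | "x \<in> {1..int n} - {i, j, k, l}" using x by blast
    then show ?thesis by cases (simp_all only: abs v(5))
  qed
  \<comment> \<open>The map of absolute values is its own inverse.\<close>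
  have "bij_betw (\<lambda>x. \<bar>\<pi> x\<bar>) {1..int n} {1..int n}"
    by (rule bij_betw_byWitness[where f' = "\<lambda>x. \<bar>\<pi> x\<bar>"]) (use range absabs in auto)
  then have "\<pi> \<in> signed_involutions n"
    using odd out inv by (simp add: signed_involutions_def signed_perms_def)
  moreover have "cyc2 n \<pi> = 2"
    using two_cycles_arc_map[OF assms] idx by (simp add: cyc2_def n_def two_cycles_def)
  moreover have "fix_B n \<pi> = f"
  proof -
    have "{x \<in> {1..int n}. \<bar>\<pi> x\<bar> = x} = {1..int n} - {i, j, k, l}"
    proof -
      have "x \<notin> {i, j, k, l}" if "\<bar>\<pi> x\<bar> = x" for x
        using that abs idx by (metis insertE emptyE less_irrefl)
      then show ?thesis using v(5) by blast
    qed
    moreover have "card ({1..int n} - {i, j, k, l}) = n - 4"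
      using idx by (subst card_Diff_subset) auto
    ultimately show ?thesis by (simp add: fix_B_def n_def)
  qed
  ultimately show ?thesis by (simp add: n_def)
qed

lemma signed_involution_in_arc_maps:
  assumes "\<pi> \<in> signed_involutions n" "cyc2 n \<pi> = 2"
  obtains i j k l s s' where "(i, j, k, l) \<in> arc_pairs n" "s \<in> signs" "s' \<in> signs"
    "\<pi> \<in> arc_maps n (i, j, k, l) (s, s')"
proof -
  have odd: "\<pi> (- x) = - \<pi> x" and out: "x > int n \<Longrightarrow> \<pi> x = x" and inv: "\<pi> (\<pi> x) = x" for x
    using assms(1) by (auto simp: signed_involutions_def signed_perms_def pointfree_idE)
  have range: "\<bar>\<pi> x\<bar> \<in> {1..int n}" if "x \<in> {1..int n}" for x
    using assms(1) that by (auto simp: signed_involutions_def signed_perms_def bij_betw_def)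
  have sign: "\<exists>s\<in>signs. \<pi> x = s * y \<and> \<pi> y = s * x" if "\<bar>\<pi> x\<bar> = y" for x y
  proof (cases "\<pi> x \<ge> 0")
    case True
    then show ?thesis using that inv[of x] by (auto simp: signs_def)
  next
    case False
    then have "\<pi> x = - y" using that by simp
    then show ?thesis using inv[of x] odd[of y] by (intro bexI[of _ "-1"]) (auto simp: signs_def)
  qed
  have "card (two_cycles n \<pi>) = 2"
    using assms(2) by (simp add: cyc2_def two_cycles_def)
  then obtain p q where pq: "two_cycles n \<pi> = {p, q}" "p \<noteq> q"
    by (auto simp: card_2_iff)
  obtain i j k l where arcs: "two_cycles n \<pi> = {(i, j), (k, l)}" "(i, j) \<noteq> (k, l)" "i \<le> k"
  proof (cases "fst p \<le> fst q")
    case True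
    then show ?thesis using pq that[of "fst p" "snd p" "fst q" "snd q"] by simp
  next
    case False
    then show ?thesis using pq that[of "fst q" "snd q" "fst p" "snd p"] by (simp add: insert_commute)
  qed
  have in_cyc: "(i, j) \<in> two_cycles n \<pi>" "(k, l) \<in> two_cycles n \<pi>" using arcs by auto
  then have ij: "0 < i" "i < j" "j \<le> int n" "\<bar>\<pi> i\<bar> = j" "\<bar>\<pi> j\<bar> = i"
    and kl: "0 < k" "k < l" "l \<le> int n" "\<bar>\<pi> k\<bar> = l" "\<bar>\<pi> l\<bar> = k"
    by (auto simp: two_cycles_def)
  have "(i, j, k, l) \<in> arc_pairs n"
  proof -
    \<comment> \<open>Distinct 2-cycles of an involution share no entry; in particular
      \<open>i \<le> k\<close> is strict.\<close>
    have "i \<noteq> k" "j \<noteq> k" "j \<noteq> l" using ij kl arcs(2,3) by auto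
    then show ?thesis using ij(1-3) kl(2,3) arcs(3) by (simp add: arc_pairs_def)
  qed
  moreover obtain s where s: "s \<in> signs" "\<pi> i = s * j" "\<pi> j = s * i" using sign[OF ij(4)] by blast
  moreover obtain s' where s': "s' \<in> signs" "\<pi> k = s' * l" "\<pi> l = s' * k" using sign[OF kl(4)] by blast
  moreover have "\<pi> \<in> arc_maps n (i, j, k, l) (s, s')"
  proof -
    \<comment> \<open>A point moved by the map of absolute values lies in a 2-cycle, hence is one of
      the four entries.\<close>
    have fixed: "\<bar>\<pi> x\<bar> = x" if "x \<in> {1..int n}" "x \<notin> {i, j, k, l}" for x
    proof (rule ccontr)
      assume "\<bar>\<pi> x\<bar> \<noteq> x"
      moreover have "\<bar>\<pi> \<bar>\<pi> x\<bar>\<bar> = x"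
        using inv[of x] odd[of "\<pi> x"] that(1) by (cases "\<pi> x \<ge> 0") auto
      ultimately have "(x, \<bar>\<pi> x\<bar>) \<in> two_cycles n \<pi> \<or> (\<bar>\<pi> x\<bar>, x) \<in> two_cycles n \<pi>"
        using that(1) range[OF that(1)] by (auto simp: two_cycles_def)
      then show False using that(2) arcs(1) by auto
    qed
    have "\<pi> x \<in> {x, - x}" if "x \<in> {1..int n}" "x \<notin> {i, j, k, l}" for x
      using fixed[OF that] by (auto simp: abs_if split: if_splits)
    then have "\<pi> x \<in> arc_values (i, j, k, l) (s, s') x" if "x \<in> {1..int n}" for x
      using s s' that by simp
    then show ?thesis using odd out by (simp add: arc_maps_def signed_maps_def)
  qed
  ultimately show ?thesis using that by blast
qed

text \<open>The index set of \<open>F\<close> is the disjoint union of the classes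
  \<open>arc_maps\<close>, and \<open>sum_des_B_signed_maps\<close> evaluates each class.\<close>

lemma F_2_eq_sum_wsum:
  "F 2 f = (\<Sum>p\<in>arc_pairs (4 + f). \<Sum>\<epsilon>\<in>signs \<times> signs. wsum tvar (arc_values p \<epsilon>) 0 (4 + f) 0)"
proof -
  let ?n = "4 + f"
  let ?I = "arc_pairs ?n \<times> (signs \<times> signs)"
  have S_eq: "{\<pi> \<in> signed_involutions ?n. cyc2 ?n \<pi> = 2 \<and> fix_B ?n \<pi> = f}
      = (\<Union>(p, \<epsilon>)\<in>?I. arc_maps ?n p \<epsilon>)" (is "?S = _")
  proof (intro equalityI subsetI)
    fix \<pi> assume "\<pi> \<in> ?S"
    then obtain i j k l s s' where "(i, j, k, l) \<in> arc_pairs ?n" "s \<in> signs" "s' \<in> signs"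
      "\<pi> \<in> arc_maps ?n (i, j, k, l) (s, s')"
      using signed_involution_in_arc_maps by blast
    then show "\<pi> \<in> (\<Union>(p, \<epsilon>)\<in>?I. arc_maps ?n p \<epsilon>)" by blast
  next
    fix \<pi> assume "\<pi> \<in> (\<Union>(p, \<epsilon>)\<in>?I. arc_maps ?n p \<epsilon>)"
    then show "\<pi> \<in> ?S" using arc_maps_subset by fastforce
  qed
  have fin: "finite ?S"
    by (rule finite_subset[OF _ finite_signed_perms[of ?n]]) (auto simp: signed_involutions_def)
  have "finite ?I"
  proof -
    have "arc_pairs ?n \<subseteq> {0..int ?n} \<times> {0..int ?n} \<times> {0..int ?n} \<times> {0..int ?n}"
      by (auto simp: arc_pairs_def)
    then have "finite (arc_pairs ?n)" by (rule finite_subset) simp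
    then show ?thesis by (simp add: signs_def)
  qed
  have disj: "arc_maps ?n p \<epsilon> \<inter> arc_maps ?n p' \<epsilon>' = {}"
    if "(p, \<epsilon>) \<in> ?I" "(p', \<epsilon>') \<in> ?I" "(p, \<epsilon>) \<noteq> (p', \<epsilon>')" for p \<epsilon> p' \<epsilon>'
  proof (rule ccontr)
    obtain i j k l s r i' j' k' l' s' r' where
      eq: "p = (i, j, k, l)" "\<epsilon> = (s, r)" "p' = (i', j', k', l')" "\<epsilon>' = (s', r')"
      by (metis surj_pair)
    note I = that(1,2)[unfolded eq mem_Times_iff fst_conv snd_conv]
    assume "arc_maps ?n p \<epsilon> \<inter> arc_maps ?n p' \<epsilon>' \<noteq> {}"
    then obtain \<pi> where \<pi>: "\<pi> \<in> arc_maps ?n (i, j, k, l) (s, r)" "\<pi> \<in> arc_maps ?n (i', j', k', l') (s', r')"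
      unfolding eq by blast
    have "{(i, j), (k, l)} = {(i', j'), (k', l')}"
      using two_cycles_arc_map[of i j k l ?n s r \<pi>] two_cycles_arc_map[of i' j' k' l' ?n s' r' \<pi>] I \<pi>
      by simp
    \<comment> \<open>The swapped identification of the two pairs is excluded by
      \<open>i < k\<close> and \<open>i' < k'\<close>.\<close>
    then have "i = i' \<and> j = j' \<and> k = k' \<and> l = l'"
      using I by (auto simp: doubleton_eq_iff arc_pairs_def)
    moreover from this have "s = s' \<and> r = r'"
      using arc_map_values(1,3)[of i j k l ?n s r \<pi>] arc_map_values(1,3)[of i' j' k' l' ?n s' r' \<pi>] I \<pi>
      by (auto simp: arc_pairs_def)
    ultimately show False using that(3) eq by simp
  qed
  let ?M = "\<lambda>x. case x of (p, \<epsilon>) \<Rightarrow> arc_maps ?n p \<epsilon>"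
  have "(\<Sum>\<pi>\<in>?S. tvar ^ des_B ?n \<pi>)
      = (\<Sum>x\<in>?I. \<Sum>\<pi>\<in>?M x. tvar ^ des_B ?n \<pi>)"
    unfolding S_eq
  proof (rule sum.UNION_disjoint[OF \<open>finite ?I\<close>])
    show "\<forall>x\<in>?I. finite (?M x)"
    proof
      fix x assume "x \<in> ?I"
      then have "?M x \<subseteq> ?S" unfolding S_eq by blast
      then show "finite (?M x)" using fin by (rule finite_subset)
    qed
    show "\<forall>x\<in>?I. \<forall>y\<in>?I. x \<noteq> y \<longrightarrow> ?M x \<inter> ?M y = {}"
      using disj by (simp only: split_def) (metis prod.collapse)
  qed
  also have "\<dots> = (\<Sum>(p, \<epsilon>)\<in>?I. wsum tvar (arc_values p \<epsilon>) 0 ?n 0)"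
    by (intro sum.cong refl) (auto simp: arc_maps_def sum_des_B_signed_maps)
  finally show ?thesis
    by (simp add: F_def sum.cartesian_product)
qed

section \<open>Gap weights of the three matchings\<close>

text \<open>The empty run fits the same pattern: \<open>u\<close> dominates \<open>v\<close>, so its
  sign alone decides the comparison and the weight 1 is left.\<close>

lemma run_sum_across:
  assumes "0 \<le> p" "p + int g < \<bar>u\<bar>" "\<bar>v\<bar> \<le> p"
  shows "run_sum t p g u v = t ^ of_bool (0 < u) * gap_cross t g"
proof (cases g)
  case 0
  then have "(v < u) = (0 < u)" using assms by auto
  then show ?thesis using 0 by (simp add: gap_cross_def)
next
  case (Suc h)
  then show ?thesis
    using run_sum_big_small[of p h u v t] assms by (simp add: gap_cross_def split: nat.split)
qed

text \<open>The exponent for the empty run is kept apart, since only there are \<open>u\<close> and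
  \<open>v\<close> compared with each other.\<close>

lemma run_sum_outer:
  assumes "0 \<le> p" "p + int g < \<bar>u\<bar>" "p + int g < \<bar>v\<bar>"
  shows "run_sum t p g u v = gap_same t (of_bool (v < u)) (of_bool (0 < u) + of_bool (v < 0)) g"
proof (cases g)
  case (Suc h)
  then show ?thesis using run_sum_big_big[of p h u v t] assms by (simp add: gap_same_def)
qed (simp add: gap_same_def)

lemma run_sum_inner:
  assumes "\<bar>u\<bar> \<le> p" "\<bar>v\<bar> \<le> p"
  shows "run_sum t p g u v = gap_same t (of_bool (v < u)) 1 g"
proof (cases g)
  case (Suc h)
  then show ?thesis using run_sum_small_small[of u p v t h] assms by (simp add: gap_same_def)
qed (simp add: gap_same_def)

definition quads :: "nat \<Rightarrow> (int \<times> int \<times> int \<times> int) set" where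
  "quads n = {(a, b, c, d). 0 < a \<and> a < b \<and> b < c \<and> c < d \<and> d \<le> int n}"

text \<open>Since \<open>i < k\<close>, the first arc starts at the smallest entry \<open>a\<close>.
  Its partner is \<open>b\<close>, \<open>c\<close> or \<open>d\<close>: the separated, crossing and
  nested matching, in this order.\<close>

lemma sum_arc_pairs:
  "(\<Sum>p\<in>arc_pairs n. h p)
    = (\<Sum>(a, b, c, d)\<in>quads n. h (a, b, c, d) + h (a, c, b, d) + h (a, d, b, c) :: 'a::comm_monoid_add)"
proof -
  let ?cross = "\<lambda>(a, b, c, d). (a, c, b, d) :: int \<times> int \<times> int \<times> int"
  let ?nest = "\<lambda>(a, b, c, d). (a, d, b, c) :: int \<times> int \<times> int \<times> int"
  have fin: "finite (quads n)"
    by (rule finite_subset[of _ "{0..int n} \<times> {0..int n} \<times> {0..int n} \<times> {0..int n}"])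
      (auto simp: quads_def)
  have "arc_pairs n = (quads n \<union> ?cross ` quads n) \<union> ?nest ` quads n"
  proof (intro equalityI subrelI)
    fix i p assume "(i, p) \<in> arc_pairs n"
    moreover obtain j k l where p: "p = (j, k, l)" by (metis surj_pair)
    ultimately have "(i, j, k, l) \<in> quads n \<or> (i, k, j, l) \<in> quads n \<or> (i, k, l, j) \<in> quads n"
      by (auto simp: arc_pairs_def quads_def)
    then show "(i, p) \<in> (quads n \<union> ?cross ` quads n) \<union> ?nest ` quads n"
      unfolding p by force
  qed (auto simp: arc_pairs_def quads_def)
  moreover have "quads n \<inter> ?cross ` quads n = {}" "(quads n \<union> ?cross ` quads n) \<inter> ?nest ` quads n = {}"
    by (auto simp: quads_def)
  ultimately have "(\<Sum>p\<in>arc_pairs n. h p)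
      = (\<Sum>p\<in>quads n. h p) + (\<Sum>p\<in>?cross ` quads n. h p) + (\<Sum>p\<in>?nest ` quads n. h p)"
    using fin by (simp add: sum.union_disjoint)
  also have "\<dots> = (\<Sum>p\<in>quads n. h p) + (\<Sum>p\<in>quads n. h (?cross p)) + (\<Sum>p\<in>quads n. h (?nest p))"
    by (subst (1 2) sum.reindex) (auto simp: inj_on_def)
  finally show ?thesis by (simp add: sum.distrib split_def)
qed

text \<open>\<open>natpermute f 5\<close> consists of the lists of length 5 with sum
  \<open>f\<close>, read as the lengths of the five gaps; the offsets 1 to 4 count the entries
  passed so far.\<close>

definition quad_of_gaps :: "nat list \<Rightarrow> int \<times> int \<times> int \<times> int" where
  "quad_of_gaps v = (int (v ! 0) + 1, int (v ! 0 + v ! 1) + 2,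
     int (v ! 0 + v ! 1 + v ! 2) + 3, int (v ! 0 + v ! 1 + v ! 2 + v ! 3) + 4)"

lemma natpermute_5E:
  assumes "v \<in> natpermute f 5"
  obtains g0 g1 g2 g3 g4 where "v = [g0, g1, g2, g3, g4]" "f = g0 + g1 + g2 + g3 + g4"
  using assms by (auto simp: natpermute_def eval_nat_numeral length_Suc_conv)

lemma bij_betw_quad_of_gaps: "bij_betw quad_of_gaps (natpermute f 5) (quads (4 + f))"
proof (rule bij_betw_byWitness[where f' = "\<lambda>(a, b, c, d). [nat (a - 1), nat (b - a - 1),
    nat (c - b - 1), nat (d - c - 1), nat (4 + int f - d)]"])
  show "quad_of_gaps ` natpermute f 5 \<subseteq> quads (4 + f)"
    by (auto elim!: natpermute_5E simp: quad_of_gaps_def quads_def)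
  show "\<forall>v\<in>natpermute f 5. (case quad_of_gaps v of (a, b, c, d) \<Rightarrow> [nat (a - 1), nat (b - a - 1),
      nat (c - b - 1), nat (d - c - 1), nat (4 + int f - d)]) = v"
    by (auto elim!: natpermute_5E simp: quad_of_gaps_def)
qed (auto simp: natpermute_def quads_def quad_of_gaps_def nth_Cons')

text \<open>A Cauchy product of five series: it turns the sum over all gap lengths into one
  coefficient.\<close>

lemma fps_prod5_nth:
  fixes h0 h1 h2 h3 h4 :: "nat \<Rightarrow> 'a::comm_ring_1"
  shows "(\<Sum>v\<in>natpermute f 5. x * (h0 (v ! 0) * h1 (v ! 1) * h2 (v ! 2) * h3 (v ! 3) * h4 (v ! 4)))
    = fps_nth (fps_const x * (Abs_fps h0 * Abs_fps h1 * Abs_fps h2 * Abs_fps h3 * Abs_fps h4)) f"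
proof -
  have "fps_nth (\<Prod>j\<in>{0..4}. Abs_fps ([h0, h1, h2, h3, h4] ! j)) f
      = (\<Sum>v\<in>natpermute f 5. \<Prod>j\<in>{0..4}. fps_nth (Abs_fps ([h0, h1, h2, h3, h4] ! j)) (v ! j))"
    using fps_prod_nth[of "\<lambda>j. Abs_fps ([h0, h1, h2, h3, h4] ! j)" 4 f] by simp
  then have "fps_nth (Abs_fps h0 * Abs_fps h1 * Abs_fps h2 * Abs_fps h3 * Abs_fps h4) f
      = (\<Sum>v\<in>natpermute f 5. h0 (v ! 0) * h1 (v ! 1) * h2 (v ! 2) * h3 (v ! 3) * h4 (v ! 4))"
    by (simp add: atLeast0_atMost_Suc eval_nat_numeral mult_ac)
  then show ?thesis
    by (simp only: fps_mult_left_const_nth sum_distrib_left)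
qed

lemma sign_mult_less:
  assumes "s \<in> signs" "s' \<in> signs" "0 < x"
  shows "s * x < 0 \<longleftrightarrow> s < 0" "0 < s * x \<longleftrightarrow> 0 < s"
    "x < y \<Longrightarrow> s' * y < s * x \<longleftrightarrow> s' < 0" "x < y \<Longrightarrow> s * x < s' * y \<longleftrightarrow> 0 < s'"
  using assms by (auto simp: signs_def)

context
  fixes t :: "'a::comm_ring_1" and s s' :: int and v :: "nat list" and f :: nat
  assumes s: "s \<in> signs" and s': "s' \<in> signs" and v: "v \<in> natpermute f 5"
begin

text \<open>The entries are \<open>s * b\<close>, \<open>s * a\<close>, \<open>s' * d\<close>,
  \<open>s' * c\<close>. Each arc contributes one \<open>t\<close> whatever its sign: before its
  first entry if negative, after it if positive.\<close>

lemma wsum_separated: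
  assumes "quad_of_gaps v = (a, b, c, d)"
  shows "wsum t (arc_values (a, b, c, d) (s, s')) 0 (4 + f) 0 =
    t ^ 2 * ((1 + t) ^ (v ! 0) * gap_cross t (v ! 1) * (1 + t) ^ (v ! 2) * gap_cross t (v ! 3) * (1 + t) ^ (v ! 4))"
proof -
  obtain g0 g1 g2 g3 g4 where g: "v = [g0, g1, g2, g3, g4]" "f = g0 + g1 + g2 + g3 + g4"
    using v by (rule natpermute_5E)
  have pos: "a = int g0 + 1" "b = a + int g1 + 1" "c = b + int g2 + 1" "d = c + int g3 + 1"
    using assms by (auto simp: quad_of_gaps_def g)
  then have ord: "0 < a" "a < b" "b < c" "c < d" by auto
  have abs: "\<bar>s * x\<bar> = \<bar>x\<bar>" "\<bar>s' * x\<bar> = \<bar>x\<bar>" for x using s s' by (auto simp: signs_def)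
  have "wsum t (arc_values (a, b, c, d) (s, s')) 0 (g0 + g1 + g2 + g3 + g4 + 4) 0 =
      run_sum t 0 g0 0 (s * b) * run_sum t a g1 (s * b) (s * a) * run_sum t b g2 (s * a) (s' * d)
      * run_sum t c g3 (s' * d) (s' * c) * (1 + t) ^ g4"
    by (rule wsum_four_entries) (use ord pos abs in auto)
  also have "run_sum t 0 g0 0 (s * b) = t ^ of_bool (s * b < 0) * (1 + t) ^ g0"
    by (rule run_sum_small_big) (use ord pos abs in auto)
  also have "run_sum t a g1 (s * b) (s * a) = t ^ of_bool (0 < s * b) * gap_cross t g1"
    by (rule run_sum_across) (use ord pos abs in auto)
  also have "run_sum t b g2 (s * a) (s' * d) = t ^ of_bool (s' * d < 0) * (1 + t) ^ g2"
    by (rule run_sum_small_big) (use ord pos abs in auto)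
  also have "run_sum t c g3 (s' * d) (s' * c) = t ^ of_bool (0 < s' * d) * gap_cross t g3"
    by (rule run_sum_across) (use ord pos abs in auto)
  finally show ?thesis
    using s s' ord by (auto simp: g signs_def power2_eq_square add_ac mult_ac simp del: arc_values.simps)
qed

text \<open>The entries are \<open>s * c\<close>, \<open>s' * d\<close>, \<open>s * a\<close>,
  \<open>s' * b\<close>: both neighbours lie above gap 1, gap 2 is crossed downwards, and both
  neighbours lie below gap 3.\<close>

lemma wsum_crossing:
  assumes "quad_of_gaps v = (a, b, c, d)"
  shows "wsum t (arc_values (a, c, b, d) (s, s')) 0 (4 + f) 0 =
    t ^ (of_bool (s < 0) + of_bool (0 < s')) *
      ((1 + t) ^ (v ! 0) * gap_same t (of_bool (s' < 0)) (of_bool (0 < s) + of_bool (s' < 0)) (v ! 1)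
       * gap_cross t (v ! 2) * gap_same t (of_bool (s' < 0)) 1 (v ! 3) * (1 + t) ^ (v ! 4))"
proof -
  obtain g0 g1 g2 g3 g4 where g: "v = [g0, g1, g2, g3, g4]" "f = g0 + g1 + g2 + g3 + g4"
    using v by (rule natpermute_5E)
  have pos: "a = int g0 + 1" "b = a + int g1 + 1" "c = b + int g2 + 1" "d = c + int g3 + 1"
    using assms by (auto simp: quad_of_gaps_def g)
  then have ord: "0 < a" "a < b" "b < c" "c < d" by auto
  have abs: "\<bar>s * x\<bar> = \<bar>x\<bar>" "\<bar>s' * x\<bar> = \<bar>x\<bar>" for x using s s' by (auto simp: signs_def)
  have cmp: "s * c < 0 \<longleftrightarrow> s < 0" "0 < s * c \<longleftrightarrow> 0 < s"
    "s' * d < 0 \<longleftrightarrow> s' < 0" "0 < s' * d \<longleftrightarrow> 0 < s'" "s' * d < s * c \<longleftrightarrow> s' < 0" "s' * b < s * a \<longleftrightarrow> s' < 0"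
    by (rule sign_mult_less[OF s s'] sign_mult_less[OF s' s]; use ord in linarith)+
  have nths: "v ! 0 = g0" "v ! 1 = g1" "v ! 2 = g2" "v ! 3 = g3" "v ! 4 = g4"
    by (simp_all add: g)
  have "wsum t (arc_values (a, c, b, d) (s, s')) 0 (g0 + g1 + g2 + g3 + g4 + 4) 0 =
      run_sum t 0 g0 0 (s * c) * run_sum t a g1 (s * c) (s' * d) * run_sum t b g2 (s' * d) (s * a)
      * run_sum t c g3 (s * a) (s' * b) * (1 + t) ^ g4"
    by (rule wsum_four_entries) (use ord pos abs in auto)
  also have "run_sum t 0 g0 0 (s * c) = t ^ of_bool (s * c < 0) * (1 + t) ^ g0"
    by (rule run_sum_small_big) (use ord pos abs in auto)
  also have "run_sum t a g1 (s * c) (s' * d)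
      = gap_same t (of_bool (s' * d < s * c)) (of_bool (0 < s * c) + of_bool (s' * d < 0)) g1"
    by (rule run_sum_outer) (use ord pos abs in auto)
  also have "run_sum t b g2 (s' * d) (s * a) = t ^ of_bool (0 < s' * d) * gap_cross t g2"
    by (rule run_sum_across) (use ord pos abs in auto)
  also have "run_sum t c g3 (s * a) (s' * b) = gap_same t (of_bool (s' * b < s * a)) 1 g3"
    by (rule run_sum_inner) (use ord pos abs in auto)
  finally show ?thesis
    unfolding nths g(2) cmp power_add by (simp only: add_ac mult_ac)
qed

text \<open>The entries are \<open>s * d\<close>, \<open>s' * c\<close>, \<open>s' * b\<close>,
  \<open>s * a\<close>. The gap types are those of the crossing matching; only the comparisons
  across empty gaps differ.\<close>

lemma wsum_nested:
  assumes "quad_of_gaps v = (a, b, c, d)"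
  shows "wsum t (arc_values (a, d, b, c) (s, s')) 0 (4 + f) 0 =
    t ^ (of_bool (s < 0) + of_bool (0 < s')) *
      ((1 + t) ^ (v ! 0) * gap_same t (of_bool (0 < s)) (of_bool (0 < s) + of_bool (s' < 0)) (v ! 1)
       * gap_cross t (v ! 2) * gap_same t (of_bool (0 < s')) 1 (v ! 3) * (1 + t) ^ (v ! 4))"
proof -
  obtain g0 g1 g2 g3 g4 where g: "v = [g0, g1, g2, g3, g4]" "f = g0 + g1 + g2 + g3 + g4"
    using v by (rule natpermute_5E)
  have pos: "a = int g0 + 1" "b = a + int g1 + 1" "c = b + int g2 + 1" "d = c + int g3 + 1"
    using assms by (auto simp: quad_of_gaps_def g)
  then have ord: "0 < a" "a < b" "b < c" "c < d" by auto
  have abs: "\<bar>s * x\<bar> = \<bar>x\<bar>" "\<bar>s' * x\<bar> = \<bar>x\<bar>" for x using s s' by (auto simp: signs_def)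
  have cmp: "s * d < 0 \<longleftrightarrow> s < 0" "0 < s * d \<longleftrightarrow> 0 < s"
    "s' * c < 0 \<longleftrightarrow> s' < 0" "0 < s' * c \<longleftrightarrow> 0 < s'" "s' * c < s * d \<longleftrightarrow> 0 < s" "s * a < s' * b \<longleftrightarrow> 0 < s'"
    by (rule sign_mult_less[OF s s'] sign_mult_less[OF s' s]; use ord in linarith)+
  have nths: "v ! 0 = g0" "v ! 1 = g1" "v ! 2 = g2" "v ! 3 = g3" "v ! 4 = g4"
    by (simp_all add: g)
  have "wsum t (arc_values (a, d, b, c) (s, s')) 0 (g0 + g1 + g2 + g3 + g4 + 4) 0 =
      run_sum t 0 g0 0 (s * d) * run_sum t a g1 (s * d) (s' * c) * run_sum t b g2 (s' * c) (s' * b)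
      * run_sum t c g3 (s' * b) (s * a) * (1 + t) ^ g4"
    by (rule wsum_four_entries) (use ord pos abs in auto)
  also have "run_sum t 0 g0 0 (s * d) = t ^ of_bool (s * d < 0) * (1 + t) ^ g0"
    by (rule run_sum_small_big) (use ord pos abs in auto)
  also have "run_sum t a g1 (s * d) (s' * c)
      = gap_same t (of_bool (s' * c < s * d)) (of_bool (0 < s * d) + of_bool (s' * c < 0)) g1"
    by (rule run_sum_outer) (use ord pos abs in auto)
  also have "run_sum t b g2 (s' * c) (s' * b) = t ^ of_bool (0 < s' * c) * gap_cross t g2"
    by (rule run_sum_across) (use ord pos abs in auto)
  also have "run_sum t c g3 (s' * b) (s * a) = gap_same t (of_bool (s * a < s' * b)) 1 g3"
    by (rule run_sum_inner) (use ord pos abs in auto)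
  finally show ?thesis
    unfolding nths g(2) cmp power_add by (simp only: add_ac mult_ac)
qed

end

section \<open>Summation over all arrangements and extraction of coefficients\<close>

lemma sum_wsum_eq_fps_nth:
  fixes t :: "'a::comm_ring_1"
  defines "T \<equiv> fps_const t" and "Z \<equiv> fps_X * geo t"
  shows "(\<Sum>p\<in>arc_pairs (4 + f). \<Sum>\<epsilon>\<in>signs \<times> signs. wsum t (arc_values p \<epsilon>) 0 (4 + f) 0) =
    fps_nth (4 * T\<^sup>2 * geo t ^ 3 * (Abs_fps (gap_cross t))\<^sup>2
      + (geo t)\<^sup>2 * Abs_fps (gap_cross t) * (3 * T * (1 + 2 * T * Z)\<^sup>2
          + 2 * T\<^sup>2 * (1 + 2 * T * Z) * (1 + 2 * Z) + 3 * T ^ 3 * (1 + 2 * Z)\<^sup>2)) f"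
proof -
  let ?D = "Abs_fps (gap_cross t)" and ?N = "natpermute f 5"
  \<comment> \<open>\<open>E0\<close>, \<open>E1\<close>, \<open>E2\<close> belong to the separated,
    crossing and nested matchings; the weight behind \<open>E0\<close> is the same for all
    signs.\<close>
  define E0 where "E0 = fps_const (t ^ 2) * (geo t * ?D * geo t * ?D * geo t)"
  define E1 where "E1 s s' = fps_const (t ^ (of_bool (s < 0) + of_bool (0 < s'))) *
      (geo t * Abs_fps (gap_same t (of_bool (s' < 0)) (of_bool (0 < s) + of_bool (s' < 0)))
       * ?D * Abs_fps (gap_same t (of_bool (s' < 0)) 1) * geo t)" for s s' :: int
  define E2 where "E2 s s' = fps_const (t ^ (of_bool (s < 0) + of_bool (0 < s'))) *
      (geo t * Abs_fps (gap_same t (of_bool (0 < s)) (of_bool (0 < s) + of_bool (s' < 0)))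
       * ?D * Abs_fps (gap_same t (of_bool (0 < s')) 1) * geo t)" for s s' :: int
  have "(\<Sum>p\<in>arc_pairs (4 + f). wsum t (arc_values p \<epsilon>) 0 (4 + f) 0)
      = fps_nth (case \<epsilon> of (s, s') \<Rightarrow> E0 + E1 s s' + E2 s s') f" if \<epsilon>_mem: "\<epsilon> \<in> signs \<times> signs" for \<epsilon>
  proof -
    obtain s s' where \<epsilon>: "\<epsilon> = (s, s')" "s \<in> signs" "s' \<in> signs" using \<epsilon>_mem by auto
    let ?w = "\<lambda>p. wsum t (arc_values p (s, s')) 0 (4 + f) 0"
    let ?W = "\<lambda>v.
        t ^ 2 * ((1 + t) ^ (v ! 0) * gap_cross t (v ! 1) * (1 + t) ^ (v ! 2) * gap_cross t (v ! 3) * (1 + t) ^ (v ! 4))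
      + t ^ (of_bool (s < 0) + of_bool (0 < s')) *
        ((1 + t) ^ (v ! 0) * gap_same t (of_bool (s' < 0)) (of_bool (0 < s) + of_bool (s' < 0)) (v ! 1)
         * gap_cross t (v ! 2) * gap_same t (of_bool (s' < 0)) 1 (v ! 3) * (1 + t) ^ (v ! 4))
      + t ^ (of_bool (s < 0) + of_bool (0 < s')) *
        ((1 + t) ^ (v ! 0) * gap_same t (of_bool (0 < s)) (of_bool (0 < s) + of_bool (s' < 0)) (v ! 1)
         * gap_cross t (v ! 2) * gap_same t (of_bool (0 < s')) 1 (v ! 3) * (1 + t) ^ (v ! 4))"
    have "(\<Sum>p\<in>arc_pairs (4 + f). ?w p)
        = (\<Sum>(a, b, c, d)\<in>quads (4 + f). ?w (a, b, c, d) + ?w (a, c, b, d) + ?w (a, d, b, c))"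
      by (rule sum_arc_pairs)
    also have "\<dots> = (\<Sum>v\<in>?N. case quad_of_gaps v of (a, b, c, d) \<Rightarrow>
        ?w (a, b, c, d) + ?w (a, c, b, d) + ?w (a, d, b, c))"
      by (rule sum.reindex_bij_betw[OF bij_betw_quad_of_gaps, symmetric])
    also have "\<dots> = (\<Sum>v\<in>?N. ?W v)"
    proof (rule sum.cong[OF refl])
      fix v assume v: "v \<in> ?N"
      obtain a b c d where q: "quad_of_gaps v = (a, b, c, d)" by (metis surj_pair)
      show "(case quad_of_gaps v of (a, b, c, d) \<Rightarrow> ?w (a, b, c, d) + ?w (a, c, b, d) + ?w (a, d, b, c)) = ?W v"
        unfolding q case_prod_conv wsum_separated[OF \<epsilon>(2,3) v q] wsum_crossing[OF \<epsilon>(2,3) v q]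
          wsum_nested[OF \<epsilon>(2,3) v q] by (rule refl)
    qed
    also have "\<dots> = fps_nth (E0 + E1 s s' + E2 s s') f"
      unfolding sum.distrib fps_add_nth fps_prod5_nth E0_def E1_def E2_def geo_def by (rule refl)
    finally show ?thesis by (simp add: \<epsilon>(1))
  qed
  then have "(\<Sum>\<epsilon>\<in>signs \<times> signs. \<Sum>p\<in>arc_pairs (4 + f). wsum t (arc_values p \<epsilon>) 0 (4 + f) 0)
      = fps_nth (\<Sum>\<epsilon>\<in>signs \<times> signs. case \<epsilon> of (s, s') \<Rightarrow> E0 + E1 s s' + E2 s s') f"
    by (simp add: fps_sum_nth)
  also have "(\<Sum>\<epsilon>\<in>signs \<times> signs. case \<epsilon> of (s, s') \<Rightarrow> E0 + E1 s s' + E2 s s')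
      = 4 * E0 + (E1 1 1 + E1 1 (-1) + E1 (-1) 1 + E1 (-1) (-1))
               + (E2 1 1 + E2 1 (-1) + E2 (-1) 1 + E2 (-1) (-1))"
    by (simp add: signs_def sum.cartesian_product[symmetric])
  also have "4 * E0 = 4 * T\<^sup>2 * geo t ^ 3 * ?D\<^sup>2"
    by (simp add: E0_def T_def power2_eq_square power3_eq_cube mult_ac flip: fps_const_mult)
  \<comment> \<open>With \<open>A = 1 + 2 T Z\<close> and \<open>B = 1 + 2 Z\<close>, the four
    summands are \<open>Q^2 D\<close> times \<open>T A^2\<close>, \<open>T^2 A B\<close>,
    \<open>T^2 A B\<close>, \<open>T^3 B^2\<close>.\<close>
  also have "E1 1 1 + E1 1 (-1) + E1 (-1) 1 + E1 (-1) (-1)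
      = (geo t)\<^sup>2 * ?D * (T * (1 + 2 * T * Z)\<^sup>2 + 2 * T\<^sup>2 * (1 + 2 * T * Z) * (1 + 2 * Z) + T ^ 3 * (1 + 2 * Z)\<^sup>2)"
    by (simp add: E1_def fps_gap_same algebra_simps power2_eq_square power3_eq_cube
        flip: T_def Z_def fps_const_mult)
  \<comment> \<open>Here the factors are \<open>T^3 B^2\<close>, \<open>T A^2\<close>,
    \<open>T^3 B^2\<close>, \<open>T A^2\<close>.\<close>
  also have "E2 1 1 + E2 1 (-1) + E2 (-1) 1 + E2 (-1) (-1)
      = (geo t)\<^sup>2 * ?D * (2 * T * (1 + 2 * T * Z)\<^sup>2 + 2 * T ^ 3 * (1 + 2 * Z)\<^sup>2)"
    by (simp add: E2_def fps_gap_same algebra_simps power2_eq_square power3_eq_cube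
        flip: T_def Z_def fps_const_mult)
  finally show ?thesis
    by (subst sum.swap) (simp add: algebra_simps)
qed

text \<open>Where the subtraction \<open>n - k\<close> truncates, the binomial coefficient makes
  both sides 0.\<close>

lemma binomial_power_shift:
  fixes q :: "'a::comm_semiring_1"
  assumes "m \<le> k"
  shows "of_nat (n choose k) * q ^ (n - k) * q ^ m = of_nat (n choose k) * q ^ (n + m - k)"
proof (cases "k \<le> n")
  case True
  then show ?thesis by (simp add: mult.assoc flip: power_add)
qed (simp add: binomial_eq_0)

lemma fps_binomial_power_nth:
  "fps_nth (geo t * (fps_X * geo t) ^ k) n = of_nat (n choose k) * (1 + t) ^ (n - k)"
  by (simp flip: fps_binomial_power)

theorem corollary6p5:
  fixes f :: nat
  shows "F 2 f =
      of_nat (6 * f + 3) * tvar * (1 + tvar) ^ (f + 2)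
    + of_nat (24 * f + 60 * (f choose 2)) * tvar ^ 2 * (1 + tvar) ^ f
    + of_nat (48 * (f choose 2) + 192 * (f choose 3)) * tvar ^ 3 * (1 + tvar) ^ (f - 2)
    + of_nat (192 * (f choose 4)) * tvar ^ 4 * (1 + tvar) ^ (f - 4)"
proof -
  define t where "t = tvar"
  define q where "q = 1 + t"
  define b where "b k = of_nat (f choose k) * q ^ (f - k)" for k
  define P where "P k = geo t * (fps_X * geo t) ^ k" for k
  let ?T = "fps_const t" and ?Z = "fps_X * geo t"
  have P: "fps_nth (P k) f = b k" for k
    by (simp only: P_def b_def q_def fps_binomial_power_nth)
  have q: "1 + ?T = fps_const q" by (simp add: q_def flip: fps_const_add)
  have "F 2 f = fps_nth (4 * ?T\<^sup>2 * geo t ^ 3 * (Abs_fps (gap_cross t))\<^sup>2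
      + (geo t)\<^sup>2 * Abs_fps (gap_cross t) * (3 * ?T * (1 + 2 * ?T * ?Z)\<^sup>2
          + 2 * ?T\<^sup>2 * (1 + 2 * ?T * ?Z) * (1 + 2 * ?Z) + 3 * ?T ^ 3 * (1 + 2 * ?Z)\<^sup>2)) f"
    unfolding F_2_eq_sum_wsum t_def by (rule sum_wsum_eq_fps_nth)
  \<comment> \<open>The terms are collected by powers of \<open>Z\<close>, as \<open>P k\<close> is
    \<open>Q Z^k\<close>.\<close>
  also have "\<dots> = fps_nth (fps_const (3 * t * q\<^sup>2) * P 0 + fps_const (6 * t * q ^ 3 + 24 * t\<^sup>2 * q) * P 1
      + fps_const (60 * t\<^sup>2 * q\<^sup>2 + 48 * t ^ 3) * P 2 + fps_const (192 * t ^ 3 * q) * P 3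
      + fps_const (192 * t ^ 4) * P 4) f"
    unfolding generating_function_identity[OF geo_fps_gap_cross] q P_def
    by (simp add: algebra_simps numeral_fps_const fps_const_power flip: fps_const_mult fps_const_add)
  also have "\<dots> = 3 * t * q\<^sup>2 * b 0 + (6 * t * q ^ 3 + 24 * t\<^sup>2 * q) * b 1
      + (60 * t\<^sup>2 * q\<^sup>2 + 48 * t ^ 3) * b 2 + 192 * t ^ 3 * q * b 3 + 192 * t ^ 4 * b 4"
    by (simp only: fps_add_nth fps_mult_left_const_nth P)
  \<comment> \<open>Each \<open>b k\<close> is grouped with the power of \<open>q\<close> that
    brings its exponent \<open>f - k\<close> to the one wanted.\<close>
  also have "\<dots> = 3 * t * q ^ (f + 2) + 6 * t * q\<^sup>2 * (b 1 * q ^ 1) + 24 * t\<^sup>2 * (b 1 * q ^ 1)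
      + 60 * t\<^sup>2 * (b 2 * q ^ 2) + 48 * t ^ 3 * b 2 + 192 * t ^ 3 * (b 3 * q ^ 1) + 192 * t ^ 4 * b 4"
    by (simp add: b_def algebra_simps power_add power3_eq_cube power2_eq_square)
  also have "b 1 * q ^ 1 = of_nat f * q ^ f"
    unfolding b_def by (simp only: binomial_power_shift) simp
  also have "b 2 * q ^ 2 = of_nat (f choose 2) * q ^ f"
    unfolding b_def by (simp only: binomial_power_shift) simp
  \<comment> \<open>The exponents \<open>f + 1 - 3\<close> and \<open>f - 2\<close> agree under
    truncation too.\<close>
  also have "b 3 * q ^ 1 = of_nat (f choose 3) * q ^ (f - 2)"
    unfolding b_def by (subst binomial_power_shift) (simp_all add: numeral_3_eq_3 numeral_2_eq_2)
  finally show ?thesis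
    unfolding t_def[symmetric] q_def[symmetric]
    by (simp add: b_def algebra_simps power_add power2_eq_square)
qed

end
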